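(* Let $G=(V,E)$ be a complete graph with metric cost $c:E\to\mathbb{R}_+$ and distinct endpoints $s,t\in V$. Let $x^*$ be an optimal solution to the path-variant Held-Karp relaxation, written as a convex combination $x^*=\sum_{i=1}^k\lambda_i\chi_{\mathscr{T}_i}$ of incidence vectors of spanning trees. Let $\mathscr{T}$ be sampled as $\mathscr{T}_i$ with probability $\lambda_i$; let $T$ be the set of vertices in $V\setminus\{s,t\}$ of odd degree in $\mathscr{T}$ together with those of $s,t$ of even degree in $\mathscr{T}$; let $J$ be a minimum-cost $T$-join; and let $H$ be the Hamiltonian $s$-$t$ path obtained by shortcutting an Eulerian $s$-$t$ path of the multigraph $\mathscr{T}\cup J$. Then $\mathbb{E}[c(H)]\le\frac{9-\sqrt{33}}{2}\,c(x^* )$.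
   Context: For $F\subseteq E$, $\chi_F$ is its incidence vector; $x(F)=\sum_{e\in F}x_e$; $c(x)=\sum_ec_ex_e$; $\delta(S)$ is the set of edges with exactly one endpoint in $S$. The path-variant Held-Karp relaxation: minimize $c(x)$ subject to $x(\delta(S))\ge1$ for all $S\subsetneq V$ with $|S\cap\{s,t\}|=1$; $x(\delta(S))\ge2$ for all nonempty $S\subsetneq V$ with $|S\cap\{s,t\}|\ne1$; $x(\delta(\{s\}))=x(\delta(\{t\}))=1$; $x(\delta(\{v\}))=2$ for $v\in V\setminus\{s,t\}$; $x\ge0$. A $T$-join is an edge set whose set of odd-degree vertices is exactly $T$. *)

theory Defs
  imports "HOL-Probability.Probability" "HOL-Library.Sublist"
begin

section \<open>Undirected graphs\<close>

text \<open>
  A simple undirected graph on the vertex set \<open>V\<close> is given by its edge set, an edge being a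
  two-element set of vertices. A vector indexed by edges is a function \<open>'a set \<Rightarrow> real\<close> of which
  only the values on edges matter. The cost of an edge set \<open>F\<close> and the number \<open>x(F)\<close> are \<open>sum c F\<close>
  and \<open>sum x F\<close>, and the incidence vector of \<open>F\<close> is \<open>indicator F\<close>.
\<close>

definition complete_edges :: "'a set \<Rightarrow> 'a set set" where
  "complete_edges V = {e. e \<subseteq> V \<and> card e = 2}"

definition metric_cost :: "'a set \<Rightarrow> ('a set \<Rightarrow> real) \<Rightarrow> bool" where
  "metric_cost V c \<longleftrightarrow>
     (\<forall>e \<in> complete_edges V. 0 \<le> c e) \<and>
     (\<forall>u \<in> V. \<forall>v \<in> V. \<forall>w \<in> V. distinct [u, v, w] \<longrightarrow> c {u, w} \<le> c {u, v} + c {v, w})"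

definition vertex_degree :: "'a set set \<Rightarrow> 'a \<Rightarrow> nat" where
  "vertex_degree F v = card {e \<in> F. v \<in> e}"

definition connected_on :: "'a set \<Rightarrow> 'a set set \<Rightarrow> bool" where
  "connected_on V F \<longleftrightarrow> (\<forall>u \<in> V. \<forall>v \<in> V. (u, v) \<in> {(a, b). {a, b} \<in> F}\<^sup>*)"

definition path_edges :: "'a list \<Rightarrow> 'a set list" where
  "path_edges vs = map2 (\<lambda>u v. {u, v}) vs (tl vs)"

definition is_cycle :: "'a set set \<Rightarrow> 'a list \<Rightarrow> bool" where
  "is_cycle F vs \<longleftrightarrow>
     3 \<le> length vs \<and> distinct vs \<and> set (path_edges vs) \<subseteq> F \<and> {last vs, hd vs} \<in> F"

definition spanning_tree :: "'a set \<Rightarrow> 'a set set \<Rightarrow> bool" where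
  "spanning_tree V F \<longleftrightarrow> F \<subseteq> complete_edges V \<and> connected_on V F \<and> (\<nexists>vs. is_cycle F vs)"

section \<open>The path-variant Held-Karp relaxation\<close>

definition cut_edges :: "'a set \<Rightarrow> 'a set \<Rightarrow> 'a set set" where
  "cut_edges V S = {e \<in> complete_edges V. card (e \<inter> S) = 1}"

definition lp_cost :: "'a set \<Rightarrow> ('a set \<Rightarrow> real) \<Rightarrow> ('a set \<Rightarrow> real) \<Rightarrow> real" where
  "lp_cost V c x = (\<Sum>e \<in> complete_edges V. c e * x e)"

definition held_karp_feasible :: "'a set \<Rightarrow> 'a \<Rightarrow> 'a \<Rightarrow> ('a set \<Rightarrow> real) \<Rightarrow> bool" where
  "held_karp_feasible V s t x \<longleftrightarrow>
     (\<forall>S. S \<subset> V \<and> card (S \<inter> {s, t}) = 1 \<longrightarrow> sum x (cut_edges V S) \<ge> 1) \<and>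
     (\<forall>S. S \<noteq> {} \<and> S \<subset> V \<and> card (S \<inter> {s, t}) \<noteq> 1 \<longrightarrow> sum x (cut_edges V S) \<ge> 2) \<and>
     sum x (cut_edges V {s}) = 1 \<and> sum x (cut_edges V {t}) = 1 \<and>
     (\<forall>v \<in> V - {s, t}. sum x (cut_edges V {v}) = 2) \<and>
     (\<forall>e \<in> complete_edges V. 0 \<le> x e)"

definition held_karp_optimal ::
  "'a set \<Rightarrow> ('a set \<Rightarrow> real) \<Rightarrow> 'a \<Rightarrow> 'a \<Rightarrow> ('a set \<Rightarrow> real) \<Rightarrow> bool" where
  "held_karp_optimal V c s t x \<longleftrightarrow>
     held_karp_feasible V s t x \<and>
     (\<forall>y. held_karp_feasible V s t y \<longrightarrow> lp_cost V c x \<le> lp_cost V c y)"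

section \<open>Joins, Eulerian paths and shortcutting\<close>

definition wrong_degree_vertices :: "'a set \<Rightarrow> 'a \<Rightarrow> 'a \<Rightarrow> 'a set set \<Rightarrow> 'a set" where
  "wrong_degree_vertices V s t F =
     {v \<in> V - {s, t}. odd (vertex_degree F v)} \<union> {v \<in> {s, t}. even (vertex_degree F v)}"

definition is_join :: "'a set \<Rightarrow> 'a set \<Rightarrow> 'a set set \<Rightarrow> bool" where
  "is_join V T J \<longleftrightarrow> J \<subseteq> complete_edges V \<and> {v \<in> V. odd (vertex_degree J v)} = T"

definition min_cost_join :: "'a set \<Rightarrow> ('a set \<Rightarrow> real) \<Rightarrow> 'a set \<Rightarrow> 'a set set \<Rightarrow> bool" where
  "min_cost_join V c T J \<longleftrightarrow>
     is_join V T J \<and> (\<forall>J'. is_join V T J' \<longrightarrow> sum c J \<le> sum c J')"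

text \<open>
  A multigraph is a multiset of edges. An Eulerian path is recorded by the sequence of vertices
  it visits, which traverses every edge as often as it occurs in the multigraph.
\<close>

definition eulerian_path :: "'a set multiset \<Rightarrow> 'a \<Rightarrow> 'a \<Rightarrow> 'a list \<Rightarrow> bool" where
  "eulerian_path M s t vs \<longleftrightarrow>
     vs \<noteq> [] \<and> hd vs = s \<and> last vs = t \<and> mset (path_edges vs) = M"

definition hamiltonian_path :: "'a set \<Rightarrow> 'a \<Rightarrow> 'a \<Rightarrow> 'a list \<Rightarrow> bool" where
  "hamiltonian_path V s t vs \<longleftrightarrow>
     vs \<noteq> [] \<and> hd vs = s \<and> last vs = t \<and> distinct vs \<and> set vs = V"

text \<open>
  Shortcutting keeps one visit to each vertex of the walk \<open>W\<close>, in the order of the walk. Which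
  visit is kept is left open, except that the result must still run from \<open>s\<close> to \<open>t\<close>; keeping
  the first visit everywhere would be wrong when \<open>W\<close> passes through \<open>t\<close> before its end.
\<close>

definition hamiltonian_shortcut :: "'a set \<Rightarrow> 'a \<Rightarrow> 'a \<Rightarrow> 'a list \<Rightarrow> 'a list \<Rightarrow> bool" where
  "hamiltonian_shortcut V s t W H \<longleftrightarrow> subseq H W \<and> hamiltonian_path V s t H"

end

theory Submission
  imports Defs
begin

text \<open>
  By shortcutting, \<open>H\<close> costs at most \<open>c(\<T>) + c(J)\<close>, and the first term has expectation \<open>c(x)\<close>. A minimum-cost
  \<open>T\<close>-join costs at most any fractional vector covering all \<open>T\<close>-odd cuts. Start with \<open>\<alpha> \<chi>\<^sub>\<T> + \<beta> x\<close>, where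
  \<open>\<alpha> = (1 - \<tau>) / (3 - \<tau>)\<close> and \<open>\<beta> = 1 / (3 - \<tau>)\<close>. This covers every \<open>T\<close>-odd cut except possibly those
  separating \<open>s\<close> from \<open>t\<close> with \<open>x\<close>-value \<open>1 + w < 1 + \<tau>\<close>. Uncrossing shows that these narrow cuts form a
  chain, so the edges of each of them that avoid the preceding one are disjoint for different cuts,
  and their \<open>x\<close>-value is at least \<open>1 - \<tau>/2 + w/2\<close>. The deficit \<open>\<beta> (\<tau> - w)\<close> of a narrow cut is repaired by
  scaling \<open>x\<close> on these edges. A narrow cut is \<open>T\<close>-odd only if \<open>\<T>\<close> crosses it an even number of times,
  hence with probability at most \<open>w\<close>. Maximising over \<open>w\<close> and minimising over \<open>\<tau>\<close> gives \<open>\<tau> = 1 - u/4\<close> with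
  \<open>u = (1 + \<surd>33)/4\<close>, and the ratio is \<open>5 - 2u\<close>.
\<close>

section \<open>Cuts and joins\<close>

lemma finite_complete_edges: "finite V \<Longrightarrow> finite (complete_edges V)"
  unfolding complete_edges_def by (rule finite_subset[of _ "Pow V"]) auto

lemma doubleton_in_complete_edges:
  "{a, b} \<in> complete_edges V \<longleftrightarrow> a \<in> V \<and> b \<in> V \<and> a \<noteq> b"
  by (auto simp: complete_edges_def card_2_iff doubleton_eq_iff)

lemma complete_edgesE:
  assumes "e \<in> complete_edges V"
  obtains a b where "e = {a, b}" "a \<in> V" "b \<in> V" "a \<noteq> b"
  using assms by (auto simp: complete_edges_def card_2_iff)

lemma doubleton_in_cut_edges:
  "{a, b} \<in> cut_edges V S \<longleftrightarrow> a \<in> V \<and> b \<in> V \<and> (a \<in> S) \<noteq> (b \<in> S)"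
  by (cases "a \<in> S"; cases "b \<in> S"; cases "a = b")
     (auto simp: cut_edges_def complete_edges_def)

lemma cut_edgesE:
  assumes "e \<in> cut_edges V S"
  obtains a b where "e = {a, b}" "a \<in> V" "b \<in> V" "a \<in> S" "b \<notin> S"
proof -
  have "e \<in> complete_edges V"
    using assms by (auto simp: cut_edges_def)
  then obtain a b where "e = {a, b}"
    by (rule complete_edgesE)
  then show thesis
    using assms that[of a b] that[of b a] by (auto simp: doubleton_in_cut_edges insert_commute)
qed

lemma cut_edges_subset: "cut_edges V S \<subseteq> complete_edges V"
  by (auto simp: cut_edges_def)

lemma cut_edges_Diff: "cut_edges V (V - S) = cut_edges V S"
proof (intro equalityI subsetI)
  fix e
  show "e \<in> cut_edges V S" if "e \<in> cut_edges V (V - S)"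
    using that by (rule cut_edgesE) (auto simp: doubleton_in_cut_edges)
  show "e \<in> cut_edges V (V - S)" if "e \<in> cut_edges V S"
    using that by (rule cut_edgesE) (auto simp: doubleton_in_cut_edges)
qed

lemma even_card_sym_diff:
  assumes "finite A" "finite B"
  shows "even (card (sym_diff A B)) \<longleftrightarrow> even (card A + card B)"
proof -
  have "card (sym_diff A B) = card (A - B) + card (B - A)"
    using assms by (intro card_Un_disjoint) auto
  moreover have "card A = card (A \<inter> B) + card (A - B)"
    by (rule card_Int_Diff[OF assms(1)])
  moreover have "card B = card (A \<inter> B) + card (B - A)"
    using card_Int_Diff[OF assms(2), of A] by (simp add: inf_commute)
  ultimately show ?thesis
    by auto
qed

lemma sum_sym_diff:
  fixes f :: "'a \<Rightarrow> real"
  assumes "finite A" "finite B"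
  shows "sum f (sym_diff A B) = sum f A + sum f B - 2 * sum f (A \<inter> B)"
proof -
  have "sum f (sym_diff A B) = sum f (A - B) + sum f (B - A)"
    using assms by (intro sum.union_disjoint) auto
  moreover have "sum f A = sum f (A \<inter> B) + sum f (A - B)"
    by (rule sum.Int_Diff[OF assms(1)])
  moreover have "sum f B = sum f (A \<inter> B) + sum f (B - A)"
    using sum.Int_Diff[OF assms(2), of f A] by (simp add: inf_commute)
  ultimately show ?thesis
    by simp
qed

section \<open>Joins and the parity of cuts\<close>

lemma is_join_empty: "is_join V {} {}"
  by (simp add: is_join_def vertex_degree_def)

text \<open>Degrees add modulo 2 under symmetric difference. Joins are rerouted below by combining
  them with a single edge or a cost-free join; writing the ends as \<open>sym_diff {a} {b}\<close>
  covers \<open>a = b\<close>, where that set is empty.\<close>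

lemma is_join_sym_diff:
  assumes "finite V" "is_join V T J" "is_join V T' J'"
  shows "is_join V (sym_diff T T') (sym_diff J J')"
proof -
  have fin: "finite J" "finite J'"
    using assms finite_complete_edges finite_subset unfolding is_join_def by metis+
  have deg: "odd (vertex_degree (sym_diff J J') v) \<longleftrightarrow> odd (vertex_degree J v + vertex_degree J' v)" for v
  proof -
    have "{e \<in> sym_diff J J'. v \<in> e} = sym_diff {e \<in> J. v \<in> e} {e \<in> J'. v \<in> e}"
      by auto
    then show ?thesis
      unfolding vertex_degree_def using fin even_card_sym_diff[of "{e \<in> J. v \<in> e}" "{e \<in> J'. v \<in> e}"]
      by simp
  qed
  have T: "T = {v \<in> V. odd (vertex_degree J v)}" "T' = {v \<in> V. odd (vertex_degree J' v)}"
    using assms by (auto simp: is_join_def)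
  show ?thesis
    unfolding is_join_def using assms(2,3)
    by (simp only: deg T) (auto simp: is_join_def)
qed

lemma is_join_edge:
  assumes "a \<in> V" "b \<in> V" "a \<noteq> b"
  shows "is_join V (sym_diff {a} {b}) {{a, b}}"
proof -
  have "vertex_degree {{a, b}} v = (if v \<in> {a, b} then 1 else 0)" for v
  proof -
    have "{e \<in> {{a, b}}. v \<in> e} = (if v \<in> {a, b} then {{a, b}} else {})"
      by auto
    then show ?thesis
      by (simp add: vertex_degree_def)
  qed
  then show ?thesis
    using assms by (auto simp: is_join_def doubleton_in_complete_edges split: if_splits)
qed

text \<open>Counting the incidences between \<open>S\<close> and \<open>J\<close> in two ways
  equates the sum of the degrees in \<open>S\<close> with the sum of
  \<open>card (e \<inter> S)\<close>; modulo 2 only odd vertices and crossing edges remain.\<close>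

lemma odd_join_cut_iff:
  assumes "finite V" "is_join V T J" "S \<subseteq> V"
  shows "odd (card (J \<inter> cut_edges V S)) \<longleftrightarrow> odd (card (S \<inter> T))"
proof -
  have J: "J \<subseteq> complete_edges V" and T: "T = {v \<in> V. odd (vertex_degree J v)}"
    using assms by (auto simp: is_join_def)
  have fin: "finite J" "finite S"
    using J assms finite_complete_edges finite_subset by metis+
  have "(\<Sum>v\<in>S. vertex_degree J v) = (\<Sum>v\<in>S. \<Sum>e\<in>J. of_bool (v \<in> e))"
    unfolding vertex_degree_def using fin by (intro sum.cong) (auto simp: Int_def)
  also have "\<dots> = (\<Sum>e\<in>J. \<Sum>v\<in>S. of_bool (v \<in> e))"
    by (rule sum.swap)
  also have "\<dots> = (\<Sum>e\<in>J. card (e \<inter> S))"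
    using fin by (intro sum.cong) (auto simp: Int_def conj_commute)
  finally have "even (card {v \<in> S. odd (vertex_degree J v)}) \<longleftrightarrow> even (card {e \<in> J. odd (card (e \<inter> S))})"
    using even_sum_iff[OF fin(2), of "vertex_degree J"] even_sum_iff[OF fin(1), of "\<lambda>e. card (e \<inter> S)"]
    by simp
  moreover have "{v \<in> S. odd (vertex_degree J v)} = S \<inter> T"
    using T assms(3) by auto
  moreover have "{e \<in> J. odd (card (e \<inter> S))} = J \<inter> cut_edges V S"
  proof -
    have "odd (card (e \<inter> S)) \<longleftrightarrow> card (e \<inter> S) = 1" if "e \<in> J" for e
    proof -
      have "card e = 2" "finite e"
        using that J by (auto simp: complete_edges_def card_ge_0_finite)
      then have "card (e \<inter> S) \<le> 2"
        by (metis card_mono inf_le1)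
      then have "card (e \<inter> S) \<in> {0, 1, 2}"
        by auto
      then show ?thesis
        by auto
    qed
    then show ?thesis
      using J by (auto simp: cut_edges_def)
  qed
  ultimately show ?thesis
    by simp
qed

section \<open>Minimum-cost joins against fractional joins\<close>

text \<open>
  Among all joins of \<open>T \<triangle> {r, v}\<close>, with \<open>r\<close> fixed and \<open>v\<close> arbitrary, let \<open>F1\<close> be a cheapest one. The
  cut is bounded by the set \<open>D\<close> of vertices reachable from \<open>v\<close> at cost \<open>0\<close>: by minimality \<open>F1\<close> does not
  cross it. If an optimal \<open>T\<close>-join \<open>F\<close> crossed it more than once, exchanging between \<open>F\<close> and \<open>F1\<close> the part \<open>C\<close>
  of \<open>F \<triangle> F1\<close> left after removing a path from \<open>r\<close> to its first vertex in \<open>D\<close> would give another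
  cheapest join that does cross it.
\<close>

lemma tight_cut_exists:
  assumes V: "finite V" and nonneg: "\<And>e. e \<in> complete_edges V \<Longrightarrow> 0 \<le> c e"
    and F0: "min_cost_join V c T F0" and pos: "sum c F0 > 0"
  obtains S where "S \<subseteq> V" "odd (card (S \<inter> T))" "\<And>e. e \<in> cut_edges V S \<Longrightarrow> c e > 0"
    "\<And>F. min_cost_join V c T F \<Longrightarrow> card (F \<inter> cut_edges V S) = 1"
proof -
  note finE = finite_complete_edges[OF V]
  note sd = is_join_sym_diff[OF V]
  have join_sub: "F \<subseteq> complete_edges V" "finite F" if "is_join V A F" for A F
    using that finE finite_subset by (auto simp: is_join_def)
  have cost_zero: "sum c (sym_diff A Z) = sum c A"
    if "finite A" "Z \<subseteq> complete_edges V" "sum c Z = 0" for A Z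
  proof -
    have "finite Z"
      using that finE finite_subset by auto
    then have "\<forall>e\<in>Z. c e = 0"
      using that nonneg by (subst (asm) sum_nonneg_eq_0_iff) auto
    then show ?thesis
      using \<open>finite A\<close> \<open>finite Z\<close> by (simp add: sum_sym_diff)
  qed
  have F0j: "is_join V T F0" and F0min: "\<And>F. is_join V T F \<Longrightarrow> sum c F0 \<le> sum c F"
    using F0 by (auto simp: min_cost_join_def)
  \<comment> \<open>Deleting an edge of positive cost at \<open>r\<close> turns \<open>F0\<close>
    into a cheaper member of \<open>joins\<close>, so \<open>F1\<close> is strictly cheaper than
    \<open>F0\<close>.\<close>
  obtain e0 where e0: "e0 \<in> F0" "c e0 > 0"
    using pos by (metis not_le sum_nonpos)
  then obtain r q where rq: "e0 = {r, q}" "r \<in> V" "q \<in> V" "r \<noteq> q"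
    using join_sub(1)[OF F0j] by (meson complete_edgesE subsetD)
  define joins where "joins = {F. \<exists>u\<in>V. is_join V (sym_diff T (sym_diff {r} {u})) F}"
  have "finite joins"
    by (rule finite_subset[of _ "Pow (complete_edges V)"]) (use finE join_sub in \<open>auto simp: joins_def\<close>)
  have F0': "sym_diff F0 {e0} \<in> joins"
    unfolding joins_def rq(1) using sd[OF F0j is_join_edge[OF rq(2-4)]] rq(3)
    by (intro CollectI bexI[of _ q])
  have "sum c (sym_diff F0 {e0}) = sum c F0 - c e0"
    using e0 join_sub(2)[OF F0j] by (subst sum_sym_diff) auto
  obtain F1 where F1: "F1 \<in> joins" "\<And>F. F \<in> joins \<Longrightarrow> sum c F1 \<le> sum c F"
    using \<open>finite joins\<close> F0' arg_min_if_finite(1)[of joins "sum c"] arg_min_least[of joins _ "sum c"]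
    by blast
  have "sum c F1 < sum c F0"
    using F1(2)[OF F0'] \<open>sum c (sym_diff F0 {e0}) = _\<close> e0 by linarith
  from F1(1) obtain v where v: "v \<in> V" "is_join V (sym_diff T (sym_diff {r} {v})) F1"
    by (auto simp: joins_def)
  \<comment> \<open>Reachability at cost 0 is expressed by cost-free joins instead of walks, so that
    it composes by symmetric difference.\<close>
  define D where "D = {a \<in> V. \<exists>Z. is_join V (sym_diff {a} {v}) Z \<and> sum c Z = 0}"
  have "v \<in> D"
    unfolding D_def using v is_join_empty[of V] by (intro CollectI conjI exI[of _ "{}"]) auto
  \<comment> \<open>A cost-free join of \<open>r\<close> and \<open>v\<close> would turn
    \<open>F1\<close> into a \<open>T\<close>-join cheaper than \<open>F0\<close>.\<close>
  have "r \<notin> D"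
  proof
    assume "r \<in> D"
    then obtain Z where Z: "is_join V (sym_diff {r} {v}) Z" "sum c Z = 0"
      unfolding D_def by blast
    have "sym_diff (sym_diff T (sym_diff {r} {v})) (sym_diff {r} {v}) = T"
      by blast
    then have "is_join V T (sym_diff F1 Z)"
      using sd[OF v(2) Z(1)] by simp
    then have "sum c F0 \<le> sum c (sym_diff F1 Z)"
      by (rule F0min)
    also have "\<dots> = sum c F1"
      by (intro cost_zero join_sub(2)[OF v(2)] join_sub(1)[OF Z(1)] Z(2))
    finally show False
      using \<open>sum c F1 < sum c F0\<close> by simp
  qed
  have cut_pos: "c e > 0" if e: "e \<in> cut_edges V D" for e
  proof (rule ccontr)
    assume "\<not> c e > 0"
    then have "c e = 0"
      using nonneg[of e] e cut_edges_subset by force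
    from e obtain a b where ab: "e = {a, b}" "a \<in> V" "b \<in> V" "a \<in> D" "b \<notin> D"
      by (rule cut_edgesE)
    then obtain Z where Z: "is_join V (sym_diff {a} {v}) Z" "sum c Z = 0"
      unfolding D_def by blast
    have "a \<noteq> b"
      using ab by auto
    have "sym_diff (sym_diff {a} {v}) (sym_diff {a} {b}) = sym_diff {b} {v}"
      by blast
    then have "is_join V (sym_diff {b} {v}) (sym_diff Z {e})"
      using sd[OF Z(1) is_join_edge[OF ab(2,3) \<open>a \<noteq> b\<close>]] ab(1) by simp
    moreover have "sum c (sym_diff Z {e}) = 0"
      using cost_zero[of Z "{e}"] Z(2) join_sub(2)[OF Z(1)] \<open>c e = 0\<close> e cut_edges_subset[of V D]
      by auto
    ultimately have "b \<in> D"
      unfolding D_def using ab(3) by blast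
    then show False
      using ab by simp
  qed
  \<comment> \<open>Deleting a crossing edge \<open>{a, b}\<close> and adding a cost-free join of
    \<open>a\<close> and \<open>v\<close> moves the end \<open>v\<close> to \<open>b\<close> and
    saves \<open>c {a, b}\<close>, against the choice of \<open>F1\<close>.\<close>
  have no_cross: "F \<inter> cut_edges V D = {}"
    if F: "is_join V (sym_diff T (sym_diff {r} {v})) F" "sum c F \<le> sum c F1" for F
  proof (rule ccontr)
    assume "F \<inter> cut_edges V D \<noteq> {}"
    then obtain e where e: "e \<in> F" "e \<in> cut_edges V D"
      by auto
    from e(2) obtain a b where ab: "e = {a, b}" "a \<in> V" "b \<in> V" "a \<in> D" "b \<notin> D"
      by (rule cut_edgesE)
    then obtain Z where Z: "is_join V (sym_diff {a} {v}) Z" "sum c Z = 0"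
      unfolding D_def by blast
    have "a \<noteq> b"
      using ab by auto
    have "sym_diff (sym_diff (sym_diff T (sym_diff {r} {v})) (sym_diff {a} {b})) (sym_diff {a} {v})
        = sym_diff T (sym_diff {r} {b})"
      by blast
    then have "is_join V (sym_diff T (sym_diff {r} {b})) (sym_diff (sym_diff F {e}) Z)"
      using sd[OF sd[OF F(1) is_join_edge[OF ab(2,3) \<open>a \<noteq> b\<close>]] Z(1)] ab(1) by simp
    then have "sum c F1 \<le> sum c (sym_diff (sym_diff F {e}) Z)"
      using ab(3)
      by (intro F1(2)) (unfold joins_def, intro CollectI bexI[of _ b])
    also have "\<dots> = sum c (sym_diff F {e})"
      by (intro cost_zero finite_Diff finite_UnI finite.intros join_sub(2)[OF F(1)] join_sub(1)[OF Z(1)] Z(2))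
    also have "\<dots> = sum c F - c e"
      using e join_sub(2)[OF F(1)] by (subst sum_sym_diff) auto
    finally show False
      using cut_pos[OF e(2)] F(2) by linarith
  qed
  have DV: "D \<subseteq> V" and "finite D" "finite T"
    using V F0j finite_subset[of _ V] by (auto simp: D_def is_join_def)
  have F1cut: "F1 \<inter> cut_edges V D = {}"
    using no_cross v by simp
  \<comment> \<open>Of \<open>r\<close> and \<open>v\<close> only \<open>v\<close> lies in
    \<open>D\<close>, and \<open>F1\<close> does not cross \<open>D\<close>; parity then makes
    \<open>D \<inter> T\<close> odd.\<close>
  have "D \<inter> sym_diff T (sym_diff {r} {v}) = sym_diff (D \<inter> T) {v}"
    using \<open>v \<in> D\<close> \<open>r \<notin> D\<close> by blast
  then have oddD: "odd (card (D \<inter> T))"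
    using odd_join_cut_iff[OF V v(2) DV] F1cut even_card_sym_diff[of "D \<inter> T" "{v}"] \<open>finite D\<close>
    by simp
  have "card (F \<inter> cut_edges V D) = 1" if Fmin: "min_cost_join V c T F" for F
  proof (rule ccontr)
    assume card: "card (F \<inter> cut_edges V D) \<noteq> 1"
    have Fj: "is_join V T F" and Fle: "\<And>F'. is_join V T F' \<Longrightarrow> sum c F \<le> sum c F'"
      using Fmin by (auto simp: min_cost_join_def)
    have oddF: "odd (card (F \<inter> cut_edges V D))"
      using odd_join_cut_iff[OF V Fj DV] oddD by simp
    define X where "X = sym_diff F F1"
    have "sym_diff T (sym_diff T (sym_diff {r} {v})) = sym_diff {r} {v}"
      by blast
    then have Xj: "is_join V (sym_diff {r} {v}) X"
      using sd[OF Fj v(2)] by (simp add: X_def)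
    \<comment> \<open>\<open>R\<close> consists of the vertices reached from \<open>r\<close> inside
      \<open>X\<close> without touching \<open>D\<close>, again expressed by joins.\<close>
    define R where "R = {b \<in> V. \<exists>P \<subseteq> X. (\<forall>e\<in>P. e \<inter> D = {}) \<and> is_join V (sym_diff {r} {b}) P}"
    have "r \<in> R"
      unfolding R_def using rq is_join_empty[of V] by (intro CollectI conjI exI[of _ "{}"]) auto
    have "R \<inter> D = {}"
    proof (rule ccontr)
      assume "R \<inter> D \<noteq> {}"
      then obtain b P where b: "b \<in> D" "\<forall>e\<in>P. e \<inter> D = {}" "is_join V (sym_diff {r} {b}) P"
        unfolding R_def by blast
      have "D \<inter> sym_diff {r} {b} = {b}"
        using b \<open>r \<notin> D\<close> by auto
      moreover have "P \<inter> cut_edges V D = {}"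
        using b by (auto elim!: cut_edgesE)
      ultimately show False
        using odd_join_cut_iff[OF V b(3) DV] by simp
    qed
    \<comment> \<open>As \<open>r\<close> is the only odd vertex of \<open>X\<close> in
      \<open>R\<close>, some edge of \<open>X\<close> leaves \<open>R\<close>. Its far end must lie
      in \<open>D\<close>, since otherwise it would belong to \<open>R\<close>.\<close>
    have "R \<inter> sym_diff {r} {v} = {r}"
      using \<open>r \<in> R\<close> \<open>v \<in> D\<close> \<open>R \<inter> D = {}\<close> \<open>r \<notin> D\<close> by auto
    then have "odd (card (X \<inter> cut_edges V R))"
      using odd_join_cut_iff[OF V Xj, of R] by (auto simp: R_def)
    then have "X \<inter> cut_edges V R \<noteq> {}"
      by auto
    then obtain e where e: "e \<in> X" "e \<in> cut_edges V R"
      by auto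
    from e(2) obtain b d where bd: "e = {b, d}" "b \<in> V" "d \<in> V" "b \<in> R" "d \<notin> R"
      by (rule cut_edgesE)
    then obtain P0 where P0: "P0 \<subseteq> X" "\<forall>e\<in>P0. e \<inter> D = {}" "is_join V (sym_diff {r} {b}) P0"
      unfolding R_def by blast
    have "b \<noteq> d"
      using bd by auto
    have "sym_diff (sym_diff {r} {b}) (sym_diff {b} {d}) = sym_diff {r} {d}"
      by blast
    then have Pj: "is_join V (sym_diff {r} {d}) (sym_diff P0 {e})"
      using sd[OF P0(3) is_join_edge[OF bd(2,3) \<open>b \<noteq> d\<close>]] bd(1) by simp
    have "b \<notin> D"
      using bd \<open>R \<inter> D = {}\<close> by auto
    have "d \<in> D"
    proof (rule ccontr)
      assume "d \<notin> D"
      then have "d \<in> R"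
        unfolding R_def using Pj P0(1,2) e(1) bd(1,3) \<open>b \<notin> D\<close>
        by (intro CollectI conjI exI[of _ "sym_diff P0 {e}"]) auto
      then show False
        using bd by simp
    qed
    \<comment> \<open>What is left of \<open>X\<close> joins \<open>v\<close> to \<open>d\<close>.
      Both lie in \<open>D\<close>, so a cost-free \<open>Z\<close> closes it up, and swapping
      \<open>C\<close> together with \<open>Z\<close> preserves all degree parities.\<close>
    define C where "C = sym_diff X (sym_diff P0 {e})"
    have C: "C \<subseteq> X" "C = X - sym_diff P0 {e}"
      using P0 e by (auto simp: C_def)
    have "sym_diff (sym_diff {r} {v}) (sym_diff {r} {d}) = sym_diff {v} {d}"
      by blast
    then have Cj: "is_join V (sym_diff {v} {d}) C"
      using sd[OF Xj Pj] by (simp add: C_def)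
    obtain Z where Z: "is_join V (sym_diff {d} {v}) Z" "sum c Z = 0"
      using \<open>d \<in> D\<close> unfolding D_def by blast
    have closed: "sym_diff (sym_diff A (sym_diff {v} {d})) (sym_diff {d} {v}) = A" for A
      by blast
    have F2: "is_join V T (sym_diff (sym_diff F C) Z)"
      using sd[OF sd[OF Fj Cj] Z(1)] unfolding closed .
    have F3: "is_join V (sym_diff T (sym_diff {r} {v})) (sym_diff (sym_diff F1 C) Z)"
      using sd[OF sd[OF v(2) Cj] Z(1)] unfolding closed .
    have fin: "finite F" "finite F1" "finite C"
      using join_sub Fj v(2) Cj by blast+
    \<comment> \<open>Optimality of \<open>F\<close> means that the part of \<open>C\<close> in
      \<open>F\<close> costs at most the part in \<open>F1\<close>. Hence swapping \<open>C\<close>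
      in \<open>F1\<close> does not raise its cost.\<close>
    have "sum c F \<le> sum c (sym_diff F C)"
      using Fle[OF F2] cost_zero[of "sym_diff F C" Z] fin join_sub(1)[OF Z(1)] Z(2) by simp
    moreover have "sum c C = sum c (F \<inter> C) + sum c (F1 \<inter> C)"
    proof -
      have "C = (F \<inter> C) \<union> (F1 \<inter> C)" "(F \<inter> C) \<inter> (F1 \<inter> C) = {}"
        using C(1) by (auto simp: X_def)
      then show ?thesis
        using fin by (metis finite_Int sum.union_disjoint)
    qed
    ultimately have "sum c (sym_diff F1 C) \<le> sum c F1"
      using fin sum_sym_diff[of F C c] sum_sym_diff[of F1 C c] by simp
    then have "sum c (sym_diff (sym_diff F1 C) Z) \<le> sum c F1"
      using cost_zero[of "sym_diff F1 C" Z] fin join_sub(1)[OF Z(1)] Z(2) by simp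
    then have F3cut: "sym_diff (sym_diff F1 C) Z \<inter> cut_edges V D = {}"
      by (rule no_cross[OF F3])
    have Zcut: "Z \<inter> cut_edges V D = {}"
    proof -
      have "\<forall>e\<in>Z. c e = 0"
        using Z(2) nonneg join_sub[OF Z(1)] by (subst (asm) sum_nonneg_eq_0_iff) auto
      then show ?thesis
        using cut_pos by fastforce
    qed
    \<comment> \<open>An odd number of crossings other than one leaves a crossing edge
      \<open>f\<close> besides \<open>e\<close>. It lies in none of \<open>F1\<close>,
      \<open>P0\<close> and \<open>Z\<close>, so it survives in the swapped \<open>F1\<close>, which
      does not cross \<open>D\<close>.\<close>
    have "F \<inter> cut_edges V D \<noteq> {e}" "F \<inter> cut_edges V D \<noteq> {}"
      using card oddF by auto
    then obtain f where f: "f \<in> F" "f \<in> cut_edges V D" "f \<noteq> e"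
      by blast
    have "f \<notin> P0"
      using f(2) P0(2) by (auto elim!: cut_edgesE)
    then have "f \<in> C"
      using f F1cut by (auto simp: C(2) X_def)
    then show False
      using f F3cut F1cut Zcut by auto
  qed
  with DV oddD cut_pos show thesis
    by (rule that)
qed

text \<open>
  Edmonds and Johnson. Costs are lowered along a tight cut until an edge becomes free or another
  join becomes optimal, which can happen only finitely often.
\<close>

lemma min_cost_join_le_fractional_join:
  assumes V: "finite V" and "min_cost_join V c T F"
    and "\<And>e. e \<in> complete_edges V \<Longrightarrow> 0 \<le> c e"
    and y_nonneg: "\<And>e. e \<in> complete_edges V \<Longrightarrow> 0 \<le> y e"
    and y_cut: "\<And>S. S \<subseteq> V \<Longrightarrow> odd (card (S \<inter> T)) \<Longrightarrow> 1 \<le> sum y (cut_edges V S)"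
  shows "sum c F \<le> lp_cost V c y"
  using assms(2,3)
proof (induction "card {e \<in> complete_edges V. c e \<noteq> 0} +
    card {J. is_join V T J \<and> \<not> min_cost_join V c T J}" arbitrary: c rule: less_induct)
  case less
  let ?E = "complete_edges V"
  have finE: "finite ?E"
    using V by (rule finite_complete_edges)
  have nonneg: "\<And>e. e \<in> ?E \<Longrightarrow> 0 \<le> c e"
    by (rule less.prems(2))
  have Fj: "is_join V T F" and Fmin: "\<And>J. is_join V T J \<Longrightarrow> sum c F \<le> sum c J"
    using less.prems(1) by (auto simp: min_cost_join_def)
  have join_sub: "J \<subseteq> ?E" "finite J" if "is_join V T J" for J
    using that finE finite_subset by (auto simp: is_join_def)
  show ?case
  proof (cases "sum c F > 0")
    case False
    have "0 \<le> lp_cost V c y"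
      unfolding lp_cost_def using nonneg y_nonneg by (intro sum_nonneg mult_nonneg_nonneg)
    then show ?thesis
      using False by simp
  next
    case True
    obtain S where S: "S \<subseteq> V" "odd (card (S \<inter> T))" "\<And>e. e \<in> cut_edges V S \<Longrightarrow> c e > 0"
        and tight: "\<And>J. min_cost_join V c T J \<Longrightarrow> card (J \<inter> cut_edges V S) = 1"
      using tight_cut_exists[OF V nonneg less.prems(1) True] by blast
    define K where "K = cut_edges V S"
    have K: "K \<subseteq> ?E" "finite K"
      using cut_edges_subset[of V S] finE finite_subset by (auto simp: K_def)
    define N where "N = {J. is_join V T J \<and> \<not> min_cost_join V c T J}"
    have "N \<subseteq> Pow ?E"
      using join_sub(1) by (auto simp: N_def)
    then have finN: "finite N"
      using finE finite_subset by blast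
    have N_gt: "sum c F < sum c J" if "J \<in> N" for J
      using that Fmin[of J] less.prems(1) by (force simp: N_def min_cost_join_def)
    \<comment> \<open>The value \<open>g J\<close> solves
      \<open>sum c J - eps * card (J \<inter> K) = sum c F - eps\<close> for \<open>eps\<close>: at
      this decrease along \<open>K\<close>, \<open>J\<close> becomes as cheap as \<open>F\<close>,
      which crosses \<open>K\<close> once.\<close>
    define g where "g J = (sum c J - sum c F) / (real (card (J \<inter> K)) - 1)" for J
    define bounds where "bounds = c ` K \<union> g ` {J \<in> N. card (J \<inter> K) > 1}"
    have "F \<inter> K \<noteq> {}"
      using tight[OF less.prems(1)] by (auto simp: K_def)
    then have bounds: "finite bounds" "bounds \<noteq> {}"
      using K finN by (auto simp: bounds_def)
    \<comment> \<open>The largest decrease that keeps the costs on \<open>K\<close> nonnegative and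
      lets no join undercut \<open>F\<close>.\<close>
    define eps where "eps = Min bounds"
    have eps_le: "\<And>b. b \<in> bounds \<Longrightarrow> eps \<le> b" and eps_in: "eps \<in> bounds"
      using bounds by (auto simp: eps_def)
    have "eps > 0"
      using eps_in S(3) N_gt by (auto simp: bounds_def g_def K_def)
    define c' where "c' e = c e - (if e \<in> K then eps else 0)" for e
    have c'_nonneg: "0 \<le> c' e" if "e \<in> ?E" for e
      using eps_le[of "c e"] nonneg[OF that] by (auto simp: c'_def bounds_def)
    have c'_sum: "sum c' J = sum c J - eps * card (J \<inter> K)" if "finite J" for J
    proof -
      have "sum c' J = sum c J - (\<Sum>e\<in>J. if e \<in> K then eps else 0)"
        by (simp add: c'_def sum_subtractf)
      also have "(\<Sum>e\<in>J. if e \<in> K then eps else 0) = (\<Sum>e\<in>J \<inter> K. eps)"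
        by (rule sum.inter_restrict[OF that, symmetric])
      finally show ?thesis
        by (simp add: mult.commute)
    qed
    have c'_F: "sum c' F = sum c F - eps"
      using c'_sum[OF join_sub(2)[OF Fj]] tight[OF less.prems(1)] by (simp add: K_def)
    have c'_ge: "sum c F - eps \<le> sum c' J" if J: "is_join V T J" for J
    proof (cases "card (J \<inter> K) > 1")
      case True
      then have "J \<in> N"
        using tight[of J] J by (auto simp: N_def K_def)
      then have "eps \<le> g J"
        using True by (intro eps_le) (auto simp: bounds_def)
      then have "eps * (real (card (J \<inter> K)) - 1) \<le> sum c J - sum c F"
        using True by (simp add: g_def field_simps)
      then show ?thesis
        by (simp add: c'_sum[OF join_sub(2)[OF J]] algebra_simps)
    next
      case False
      then have "card (J \<inter> K) = 0 \<or> card (J \<inter> K) = 1"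
        by linarith
      then show ?thesis
        using Fmin[OF J] \<open>eps > 0\<close> by (auto simp: c'_sum[OF join_sub(2)[OF J]])
    qed
    have still_min: "min_cost_join V c' T J" if "min_cost_join V c T J" for J
    proof -
      have J: "is_join V T J" and "sum c J = sum c F"
        using that Fj Fmin[of J] by (auto simp: min_cost_join_def intro: antisym)
      then have "sum c' J = sum c F - eps"
        using c'_sum[OF join_sub(2)[OF J]] tight[OF that] by (simp add: K_def)
      then show ?thesis
        using J c'_ge by (simp add: min_cost_join_def)
    qed
    define N' where "N' = {J. is_join V T J \<and> \<not> min_cost_join V c' T J}"
    have "N' \<subseteq> N"
      using still_min by (auto simp: N_def N'_def)
    define A where "A = {e \<in> ?E. c e \<noteq> 0}"
    define A' where "A' = {e \<in> ?E. c' e \<noteq> 0}"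
    have "A' \<subseteq> A"
      using S(3) by (force simp: A_def A'_def c'_def K_def split: if_splits)
    have "finite A"
      using finE by (simp add: A_def)
    \<comment> \<open>Depending on which bound equals \<open>eps\<close>, an edge of
      \<open>K\<close> becomes free or a join in \<open>N\<close> becomes optimal.\<close>
    have "A' \<noteq> A \<or> N' \<noteq> N"
      using eps_in unfolding bounds_def
    proof (elim UnE imageE CollectE conjE)
      fix e assume "eps = c e" "e \<in> K"
      then have "e \<in> A" "e \<notin> A'"
        using K(1) \<open>eps > 0\<close> by (auto simp: A_def A'_def c'_def)
      then show ?thesis
        by blast
    next
      fix J assume J: "eps = g J" "J \<in> N" "1 < card (J \<inter> K)"
      then have "is_join V T J"
        by (simp add: N_def)
      have "eps * (real (card (J \<inter> K)) - 1) = sum c J - sum c F"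
        using J(1,3) by (simp add: g_def)
      then have "sum c' J = sum c F - eps"
        by (simp add: c'_sum[OF join_sub(2)[OF \<open>is_join V T J\<close>]] algebra_simps)
      then have "J \<notin> N'"
        using c'_ge by (auto simp: N'_def min_cost_join_def)
      then show ?thesis
        using J(2) by blast
    qed
    then have "card A' + card N' < card A + card N"
      using \<open>A' \<subseteq> A\<close> \<open>N' \<subseteq> N\<close> \<open>finite A\<close> finN
      by (metis add_le_less_mono add_less_le_mono card_mono psubsetI psubset_card_mono)
    then have "sum c' F \<le> lp_cost V c' y"
      using less.hyps[of c'] still_min[OF less.prems(1)] c'_nonneg
      by (simp add: A_def A'_def N_def N'_def)
    \<comment> \<open>The cost of \<open>F\<close> falls by exactly \<open>eps\<close> and that of
      \<open>y\<close> by at least \<open>eps\<close>, because \<open>y\<close> covers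
      \<open>K\<close>; so the inequality for \<open>c'\<close> implies the one for
      \<open>c\<close>.\<close>
    also have "lp_cost V c' y = lp_cost V c y - eps * sum y K"
    proof -
      have "lp_cost V c' y = lp_cost V c y - (\<Sum>e\<in>?E. if e \<in> K then eps * y e else 0)"
        unfolding lp_cost_def c'_def sum_subtractf[symmetric]
        by (intro sum.cong) (auto simp: algebra_simps)
      also have "(\<Sum>e\<in>?E. if e \<in> K then eps * y e else 0) = (\<Sum>e\<in>?E \<inter> K. eps * y e)"
        by (rule sum.inter_restrict[OF finE, symmetric])
      also have "?E \<inter> K = K"
        using K(1) by auto
      finally show ?thesis
        by (simp add: sum_distrib_left)
    qed
    also have "\<dots> \<le> lp_cost V c y - eps * 1"
      using y_cut[OF S(1,2)] \<open>eps > 0\<close>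
      by (intro diff_left_mono mult_left_mono) (auto simp: K_def)
    finally show ?thesis
      using c'_F by simp
  qed
qed

section \<open>Shortcutting\<close>

lemma path_edges_simps [simp]:
  "path_edges [] = []" "path_edges [u] = []"
  "path_edges (u # v # vs) = {u, v} # path_edges (v # vs)"
  by (simp_all add: path_edges_def)

fun walk_length :: "('a \<Rightarrow> 'a \<Rightarrow> real) \<Rightarrow> 'a list \<Rightarrow> real" where
  "walk_length d (u # v # vs) = d u v + walk_length d (v # vs)"
| "walk_length d vs = 0"

text \<open>The head \<open>u\<close> stands for the last vertex kept. Dropping the next vertex is
  one use of the triangle inequality, and dropping the end of the walk only removes nonnegative
  terms.\<close>

lemma walk_length_subseq_le:
  assumes nonneg: "\<And>u v. u \<in> V \<Longrightarrow> v \<in> V \<Longrightarrow> 0 \<le> d u v"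
    and triangle: "\<And>u v w. u \<in> V \<Longrightarrow> v \<in> V \<Longrightarrow> w \<in> V \<Longrightarrow> d u w \<le> d u v + d v w"
  shows "\<lbrakk>subseq H W; set W \<subseteq> V; u \<in> V\<rbrakk> \<Longrightarrow> walk_length d (u # H) \<le> walk_length d (u # W)"
proof (induction W arbitrary: u H)
  case Nil
  then have "H = []"
    by simp
  then show ?case
    by simp
next
  case (Cons w W)
  have w: "w \<in> V" "set W \<subseteq> V"
    using Cons.prems by auto
  show ?case
  proof (cases H)
    case Nil
    have "0 \<le> walk_length d (w # W)"
      using Cons.IH[of "[]" w] w by simp
    then show ?thesis
      using Nil nonneg[OF Cons.prems(3) w(1)] by simp
  next
    case (Cons h H')
    show ?thesis
    proof (cases "h = w")
      case True
      then have "subseq H' W"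
        using Cons.prems(1) Cons by simp
      then show ?thesis
        using Cons.IH[of H' w] w True Cons by simp
    next
      case False
      then have sub: "subseq H W"
        using Cons.prems(1) Cons by simp
      then have "h \<in> V"
        using w Cons by (auto dest: list_emb_set)
      have "walk_length d (u # H) \<le> d u w + walk_length d (w # H)"
        using triangle[OF Cons.prems(3) w(1) \<open>h \<in> V\<close>] Cons by simp
      also have "\<dots> \<le> d u w + walk_length d (w # W)"
        using Cons.IH[OF sub w(2,1)] by simp
      finally show ?thesis
        by simp
    qed
  qed
qed

lemma sum_list_path_edges:
  "set (path_edges vs) \<subseteq> complete_edges V \<Longrightarrow>
    sum_list (map c (path_edges vs)) = walk_length (\<lambda>u v. if u = v then 0 else c {u, v}) vs"
  by (induction vs rule: induct_list012) (auto simp: doubleton_in_complete_edges)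

lemma set_walk_subset:
  "set (path_edges vs) \<subseteq> complete_edges V \<Longrightarrow> hd vs \<in> V \<Longrightarrow> set vs \<subseteq> V"
  by (induction vs rule: induct_list012) (auto simp: doubleton_in_complete_edges)

lemma path_edges_subset_complete_edges:
  "distinct vs \<Longrightarrow> set vs \<subseteq> V \<Longrightarrow> set (path_edges vs) \<subseteq> complete_edges V"
  by (induction vs rule: induct_list012) (auto simp: doubleton_in_complete_edges)

lemma sum_set_le_sum_list:
  fixes f :: "'a \<Rightarrow> real"
  shows "(\<And>a. a \<in> set as \<Longrightarrow> 0 \<le> f a) \<Longrightarrow> sum f (set as) \<le> sum_list (map f as)"
proof (induction as)
  case (Cons a as)
  have "sum f (set (a # as)) \<le> f a + sum f (set as)"
    using Cons.prems[of a] by (simp add: sum.insert_if)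
  also have "\<dots> \<le> f a + sum_list (map f as)"
    using Cons by simp
  finally show ?case
    by simp
qed simp

text \<open>The walk \<open>W\<close> costs exactly \<open>sum c F + sum c J\<close>, an edge common
  to \<open>F\<close> and \<open>J\<close> being paid twice, and shortcutting does not raise the
  cost.\<close>

lemma shortcut_cost_le:
  assumes "metric_cost V c" "s \<in> V" "finite V"
    and "F \<subseteq> complete_edges V" "J \<subseteq> complete_edges V"
    and W: "eulerian_path (mset_set F + mset_set J) s t W"
    and H: "hamiltonian_shortcut V s t W H"
  shows "sum c (set (path_edges H)) \<le> sum c F + sum c J"
proof -
  \<comment> \<open>Since \<open>metric_cost\<close> constrains \<open>c\<close> only on two-element
    sets, the diagonal is set to 0. The triangle inequality then holds for all triples, including
    those where a walk returns to the same vertex.\<close>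
  define d where "d u v = (if u = v then 0 else c {u, v})" for u v
  have nonneg: "0 \<le> c e" if "e \<in> complete_edges V" for e
    using assms(1) that by (simp add: metric_cost_def)
  have d_nonneg: "0 \<le> d u v" if "u \<in> V" "v \<in> V" for u v
    using that nonneg by (simp add: d_def doubleton_in_complete_edges)
  have d_triangle: "d u w \<le> d u v + d v w" if "u \<in> V" "v \<in> V" "w \<in> V" for u v w
  proof (cases "distinct [u, v, w]")
    case True
    then show ?thesis
      using assms(1) that by (auto simp: metric_cost_def d_def)
  next
    case False
    then show ?thesis
      using d_nonneg[OF that(1,2)] d_nonneg[OF that(2,3)]
      by (auto simp: d_def split: if_splits)
  qed
  have fin: "finite F" "finite J"
    using assms finite_complete_edges finite_subset by metis+
  have W': "W \<noteq> []" "hd W = s" "mset (path_edges W) = mset_set F + mset_set J"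
    using W by (auto simp: eulerian_path_def)
  have "set (path_edges W) = set_mset (mset_set F + mset_set J)"
    using W'(3) by (metis set_mset_mset)
  then have WE: "set (path_edges W) \<subseteq> complete_edges V"
    using assms(4,5) fin by simp
  have H': "H \<noteq> []" "hd H = s" "subseq H W" "distinct H" "set H = V"
    using H by (auto simp: hamiltonian_shortcut_def hamiltonian_path_def)
  have HE: "set (path_edges H) \<subseteq> complete_edges V"
    using path_edges_subset_complete_edges[of H V] H' by simp
  obtain H1 W1 where tls: "H = s # H1" "W = s # W1"
    using H' W' by (metis list.collapse)
  have "sum c (set (path_edges H)) \<le> sum_list (map c (path_edges H))"
    using HE nonneg by (intro sum_set_le_sum_list) auto
  also have "\<dots> = walk_length d H"
    unfolding d_def by (rule sum_list_path_edges[OF HE])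
  also have "\<dots> \<le> walk_length d W"
    using H'(3) set_walk_subset[OF WE] W'(2) \<open>s \<in> V\<close> d_nonneg d_triangle unfolding tls
    by (intro walk_length_subseq_le[of V]) auto
  also have "\<dots> = sum_list (map c (path_edges W))"
    unfolding d_def by (rule sum_list_path_edges[OF WE, symmetric])
  also have "\<dots> = sum_mset (image_mset c (mset (path_edges W)))"
    by (metis mset_map sum_mset_sum_list)
  also have "\<dots> = sum c F + sum c J"
    by (simp add: W'(3) sum_unfold_sum_mset)
  finally show ?thesis .
qed

section \<open>Narrow cuts\<close>

text \<open>With all cut sums taken over the same edge set, inequalities between them can be checked
  edge by edge.\<close>

lemma sum_eq_sum_of_bool:
  fixes x :: "'b \<Rightarrow> real"
  assumes "finite A" "B \<subseteq> A"
  shows "sum x B = (\<Sum>e\<in>A. x e * of_bool (e \<in> B))"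
proof -
  have "sum x B = sum x (A \<inter> B)"
    using assms(2) by (simp add: Int_absorb1)
  also have "\<dots> = (\<Sum>e\<in>A. if e \<in> B then x e else 0)"
    by (rule sum.inter_restrict[OF assms(1)])
  also have "\<dots> = (\<Sum>e\<in>A. x e * of_bool (e \<in> B))"
    by (intro sum.cong) auto
  finally show ?thesis .
qed

definition narrow_cuts :: "'a set \<Rightarrow> 'a \<Rightarrow> 'a \<Rightarrow> ('a set \<Rightarrow> real) \<Rightarrow> real \<Rightarrow> 'a set set" where
  "narrow_cuts V s t x \<tau> = {U. U \<subseteq> V \<and> s \<in> U \<and> t \<notin> U \<and> sum x (cut_edges V U) < 1 + \<tau>}"

text \<open>Narrow cuts form a chain, so this union is the largest narrow cut properly inside \<open>U\<close>, if any.\<close>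

definition lower_cut :: "'a set \<Rightarrow> 'a \<Rightarrow> 'a \<Rightarrow> ('a set \<Rightarrow> real) \<Rightarrow> real \<Rightarrow> 'a set \<Rightarrow> 'a set" where
  "lower_cut V s t x \<tau> U = \<Union>{N \<in> narrow_cuts V s t x \<tau>. N \<subset> U}"

text \<open>These edges run between \<open>U\<close> minus its lower cut and \<open>V - U\<close>. A
  cut edge of \<open>U\<close> that starts in the lower cut also crosses the lower cut, and leaving
  it out makes the sets disjoint.\<close>

definition forward_edges ::
  "'a set \<Rightarrow> 'a \<Rightarrow> 'a \<Rightarrow> ('a set \<Rightarrow> real) \<Rightarrow> real \<Rightarrow> 'a set \<Rightarrow> 'a set set" where
  "forward_edges V s t x \<tau> U = {e \<in> cut_edges V U. e \<inter> lower_cut V s t x \<tau> U = {}}"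

lemma forward_edges_subset: "forward_edges V s t x \<tau> U \<subseteq> complete_edges V"
  using cut_edges_subset by (auto simp: forward_edges_def)

lemma finite_narrow_cuts: "finite V \<Longrightarrow> finite (narrow_cuts V s t x \<tau>)"
  by (rule finite_subset[of _ "Pow V"]) (auto simp: narrow_cuts_def)

lemma card_Int_pair_eq_1:
  "s \<noteq> t \<Longrightarrow> card (S \<inter> {s, t}) = 1 \<longleftrightarrow> (s \<in> S) \<noteq> (t \<in> S)"
  by (cases "s \<in> S"; cases "t \<in> S") auto

lemma narrow_cut_ge_1:
  assumes "held_karp_feasible V s t x" "s \<noteq> t" "t \<in> V" "U \<in> narrow_cuts V s t x \<tau>"
  shows "1 \<le> sum x (cut_edges V U)"
proof -
  have "U \<subset> V" "card (U \<inter> {s, t}) = 1"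
    using assms by (auto simp: narrow_cuts_def card_Int_pair_eq_1)
  then show ?thesis
    using assms(1) by (simp add: held_karp_feasible_def)
qed

text \<open>If \<open>A\<close> and \<open>B\<close> cross, then \<open>A - B\<close> and
  \<open>B - A\<close> are nonempty and contain neither \<open>s\<close> nor \<open>t\<close>, so
  each of their cuts has value at least 2. By uncrossing, the two values sum to at most those of
  \<open>A\<close> and \<open>B\<close>, which is less than \<open>2 + 2 * \<tau>\<close>, hence
  less than 4.\<close>

lemma narrow_cuts_chain:
  assumes V: "finite V" and x: "held_karp_feasible V s t x" and "s \<noteq> t" "t \<in> V" "\<tau> \<le> 1"
    and AB: "A \<in> narrow_cuts V s t x \<tau>" "B \<in> narrow_cuts V s t x \<tau>"
  shows "A \<subseteq> B \<or> B \<subseteq> A"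
proof (rule ccontr)
  assume not: "\<not> (A \<subseteq> B \<or> B \<subseteq> A)"
  have A: "A \<subseteq> V" "s \<in> A" "t \<notin> A" "sum x (cut_edges V A) < 1 + \<tau>"
    and B: "B \<subseteq> V" "s \<in> B" "t \<notin> B" "sum x (cut_edges V B) < 1 + \<tau>"
    using AB by (auto simp: narrow_cuts_def)
  have ge2: "2 \<le> sum x (cut_edges V (P - Q))"
    if "P \<subseteq> V" "t \<notin> P" "s \<in> Q" "\<not> P \<subseteq> Q" for P Q
  proof -
    have "P - Q \<noteq> {}" "P - Q \<subset> V" "card ((P - Q) \<inter> {s, t}) \<noteq> 1"
      using that \<open>t \<in> V\<close> \<open>s \<noteq> t\<close> by (auto simp: card_Int_pair_eq_1)
    then show ?thesis
      using x by (simp add: held_karp_feasible_def)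
  qed
  have "sum x (cut_edges V (A - B)) + sum x (cut_edges V (B - A))
      \<le> sum x (cut_edges V A) + sum x (cut_edges V B)"
    unfolding sum_eq_sum_of_bool[OF finite_complete_edges[OF V] cut_edges_subset] sum.distrib[symmetric]
  proof (rule sum_mono)
    fix e assume e: "e \<in> complete_edges V"
    then have "0 \<le> x e"
      using x by (simp add: held_karp_feasible_def)
    moreover have "of_bool (e \<in> cut_edges V (A - B)) + of_bool (e \<in> cut_edges V (B - A))
        \<le> of_bool (e \<in> cut_edges V A) + (of_bool (e \<in> cut_edges V B) :: real)"
      using e by (elim complete_edgesE) (auto simp: doubleton_in_cut_edges)
    ultimately show "x e * of_bool (e \<in> cut_edges V (A - B)) + x e * of_bool (e \<in> cut_edges V (B - A))
        \<le> x e * of_bool (e \<in> cut_edges V A) + x e * of_bool (e \<in> cut_edges V B)"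
      unfolding distrib_left[symmetric] by (rule mult_left_mono[rotated])
  qed
  then show False
    using ge2[of A B] ge2[of B A] A B not \<open>\<tau> \<le> 1\<close> by linarith
qed

text \<open>The smaller of the two cuts lies inside the lower cut of the larger one, and each of its
  forward edges has an end in it.\<close>

lemma forward_edges_disjoint:
  assumes "finite V" "held_karp_feasible V s t x" "s \<noteq> t" "t \<in> V" "\<tau> \<le> 1"
    and AB: "A \<in> narrow_cuts V s t x \<tau>" "B \<in> narrow_cuts V s t x \<tau>" "A \<noteq> B"
  shows "forward_edges V s t x \<tau> A \<inter> forward_edges V s t x \<tau> B = {}"
proof -
  have *: "forward_edges V s t x \<tau> P \<inter> forward_edges V s t x \<tau> Q = {}"
    if "P \<in> narrow_cuts V s t x \<tau>" "P \<subset> Q" for P Q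
  proof -
    have "P \<subseteq> lower_cut V s t x \<tau> Q"
      using that by (auto simp: lower_cut_def)
    then show ?thesis
      by (auto simp: forward_edges_def elim!: cut_edgesE)
  qed
  show ?thesis
    using narrow_cuts_chain[OF assms(1-7)] *[of A B] *[of B A] AB by blast
qed

text \<open>Let \<open>P\<close> be the lower cut. Placing the ends of an edge in \<open>P\<close>,
  \<open>U - P\<close> and \<open>V - U\<close> shows that the cuts of \<open>U - P\<close> and
  \<open>U\<close>, minus that of \<open>P\<close>, count each forward edge twice and every other
  edge zero times. The first cut has value at least 2, the last less than
  \<open>1 + \<tau>\<close>.\<close>

lemma sum_forward_edges_ge:
  assumes V: "finite V" and x: "held_karp_feasible V s t x" and st: "s \<noteq> t" "t \<in> V"
    and \<tau>: "0 \<le> \<tau>" "\<tau> \<le> 1" and U: "U \<in> narrow_cuts V s t x \<tau>"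
  shows "1 + sum x (cut_edges V U) - \<tau> \<le> 2 * sum x (forward_edges V s t x \<tau> U)"
proof (cases "{N \<in> narrow_cuts V s t x \<tau>. N \<subset> U} = {}")
  case True
  then have "lower_cut V s t x \<tau> U = {}"
    unfolding lower_cut_def by (simp only: Union_empty)
  then have "forward_edges V s t x \<tau> U = cut_edges V U"
    by (simp add: forward_edges_def)
  then show ?thesis
    using narrow_cut_ge_1[OF x st U] \<tau> by simp
next
  case False
  define P where "P = lower_cut V s t x \<tau> U"
  have "P \<in> {N \<in> narrow_cuts V s t x \<tau>. N \<subset> U}"
    unfolding P_def lower_cut_def
  proof (rule Union_in_chain[OF _ False])
    show "finite {N \<in> narrow_cuts V s t x \<tau>. N \<subset> U}"
      using finite_narrow_cuts[OF V] by simp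
    show "subset.chain UNIV {N \<in> narrow_cuts V s t x \<tau>. N \<subset> U}"
      unfolding subset_chain_def using narrow_cuts_chain[OF V x st \<tau>(2)] by auto
  qed
  then have P: "P \<in> narrow_cuts V s t x \<tau>" "P \<subset> U"
    by auto
  then have P': "sum x (cut_edges V P) < 1 + \<tau>" "s \<in> P"
    by (auto simp: narrow_cuts_def)
  have "U - P \<noteq> {}" "U - P \<subset> V" "card ((U - P) \<inter> {s, t}) \<noteq> 1"
    using P(2) P'(2) U st by (auto simp: narrow_cuts_def card_Int_pair_eq_1)
  then have ge2: "2 \<le> sum x (cut_edges V (U - P))"
    using x by (simp add: held_karp_feasible_def)
  have "2 * sum x (forward_edges V s t x \<tau> U) =
      (\<Sum>e\<in>complete_edges V. x e * (2 * of_bool (e \<in> forward_edges V s t x \<tau> U)))"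
    unfolding sum_eq_sum_of_bool[OF finite_complete_edges[OF V] forward_edges_subset] sum_distrib_left
    by (intro sum.cong) auto
  also have "\<dots> = (\<Sum>e\<in>complete_edges V. x e * of_bool (e \<in> cut_edges V (U - P))
      + x e * of_bool (e \<in> cut_edges V U) - x e * of_bool (e \<in> cut_edges V P))"
  proof (rule sum.cong[OF refl])
    fix e assume "e \<in> complete_edges V"
    then obtain a b where "e = {a, b}" "a \<in> V" "b \<in> V"
      by (rule complete_edgesE)
    then have "2 * of_bool (e \<in> forward_edges V s t x \<tau> U) =
        of_bool (e \<in> cut_edges V (U - P)) + of_bool (e \<in> cut_edges V U)
        - (of_bool (e \<in> cut_edges V P) :: real)"
      using P(2) unfolding forward_edges_def P_def[symmetric]
      by (cases "a \<in> P"; cases "b \<in> P"; cases "a \<in> U"; cases "b \<in> U")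
         (auto simp: doubleton_in_cut_edges)
    then show "x e * (2 * of_bool (e \<in> forward_edges V s t x \<tau> U)) =
        x e * of_bool (e \<in> cut_edges V (U - P))
        + x e * of_bool (e \<in> cut_edges V U) - x e * of_bool (e \<in> cut_edges V P)"
      by (simp only: distrib_left right_diff_distrib)
  qed
  also have "\<dots> = sum x (cut_edges V (U - P)) + sum x (cut_edges V U) - sum x (cut_edges V P)"
    by (simp add: sum_eq_sum_of_bool[OF finite_complete_edges[OF V] cut_edges_subset]
        sum.distrib sum_subtractf)
  finally show ?thesis
    using ge2 P'(1) by linarith
qed

section \<open>The expected cost of the join\<close>

text \<open>A walk in \<open>F\<close> that starts in \<open>S\<close> and uses no cut edge stays in
  \<open>S\<close>.\<close>

lemma spanning_tree_meets_cut:
  assumes F: "spanning_tree V F" and S: "S \<subseteq> V" "a \<in> S" "b \<in> V - S"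
  shows "F \<inter> cut_edges V S \<noteq> {}"
proof
  assume none: "F \<inter> cut_edges V S = {}"
  have FE: "F \<subseteq> complete_edges V"
    using F by (simp add: spanning_tree_def)
  have "(a, b) \<in> {(u, v). {u, v} \<in> F}\<^sup>*"
    using F S by (auto simp: spanning_tree_def connected_on_def)
  then have "b \<in> S"
  proof (induction rule: rtrancl_induct)
    case (step u v)
    then have "{u, v} \<in> F"
      by simp
    then have "{u, v} \<in> complete_edges V" "{u, v} \<notin> cut_edges V S"
      using FE none by auto
    then show ?case
      using step.IH by (auto simp: doubleton_in_complete_edges doubleton_in_cut_edges)
  qed (use S in simp)
  then show False
    using S by simp
qed

text \<open>The wrong-degree vertices are the symmetric difference of the odd vertices of
  \<open>F\<close> and \<open>{s, t}\<close>, so the two parities add.\<close>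

lemma odd_card_wrong_degree_iff:
  assumes V: "finite V" and F: "F \<subseteq> complete_edges V" and S: "S \<subseteq> V"
    and st: "s \<in> V" "t \<in> V" "s \<noteq> t"
  shows "odd (card (S \<inter> wrong_degree_vertices V s t F)) \<longleftrightarrow>
    odd (card (F \<inter> cut_edges V S)) \<noteq> (card (S \<inter> {s, t}) = 1)"
proof -
  define O' where "O' = {v \<in> V. odd (vertex_degree F v)}"
  have "is_join V O' F"
    using F by (simp add: is_join_def O'_def)
  then have "odd (card (F \<inter> cut_edges V S)) \<longleftrightarrow> odd (card (S \<inter> O'))"
    using odd_join_cut_iff V S by blast
  moreover have "S \<inter> wrong_degree_vertices V s t F = sym_diff (S \<inter> O') (S \<inter> {s, t})"
    using S st by (auto simp: wrong_degree_vertices_def O'_def)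
  moreover have "finite (S \<inter> O')"
    using V S finite_subset by blast
  moreover have "odd (card (S \<inter> {s, t})) \<longleftrightarrow> card (S \<inter> {s, t}) = 1"
    using st(3) by (cases "s \<in> S"; cases "t \<in> S") auto
  ultimately show ?thesis
    using even_card_sym_diff[of "S \<inter> O'" "S \<inter> {s, t}"] by auto
qed

section \<open>Covering the odd cuts by a fractional join\<close>

text \<open>
  The weight on a narrow cut \<open>U\<close> that repairs a deficit of \<open>\<alpha> \<chi>\<^sub>F + \<beta> x\<close> with
  \<open>\<alpha> = (1 - \<tau>) / (3 - \<tau>)\<close> and \<open>\<beta> = 1 / (3 - \<tau>)\<close>, when \<open>F\<close> crosses \<open>U\<close> exactly twice,
  by the forward edges of \<open>U\<close>.
\<close>

definition correction :: "'a set \<Rightarrow> ('a set \<Rightarrow> real) \<Rightarrow> real \<Rightarrow> 'a set \<Rightarrow> real" where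
  "correction V x \<tau> U =
    2 * (1 + \<tau> - sum x (cut_edges V U)) / ((3 - \<tau>) * (1 + sum x (cut_edges V U) - \<tau>))"

text \<open>The vector \<open>y\<close> is a fractional join for the wrong-degree vertices, and the
  three terms of the bound are the costs of its three parts.\<close>

lemma min_cost_join_le_correction:
  assumes V: "finite V" and st: "s \<in> V" "t \<in> V" "s \<noteq> t"
    and nonneg: "\<And>e. e \<in> complete_edges V \<Longrightarrow> 0 \<le> c e"
    and x: "held_karp_feasible V s t x" and F: "spanning_tree V F"
    and J: "min_cost_join V c (wrong_degree_vertices V s t F) J"
    and \<tau>: "0 \<le> \<tau>" "\<tau> \<le> 1"
  shows "sum c J \<le> (1 - \<tau>) / (3 - \<tau>) * sum c F + 1 / (3 - \<tau>) * lp_cost V c x +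
    (\<Sum>U\<in>narrow_cuts V s t x \<tau>. of_bool (even (card (F \<inter> cut_edges V U))) *
      (correction V x \<tau> U * (\<Sum>e\<in>forward_edges V s t x \<tau> U. c e * x e)))"
proof -
  let ?E = "complete_edges V"
  define N where "N = narrow_cuts V s t x \<tau>"
  define \<alpha> where "\<alpha> = (1 - \<tau>) / (3 - \<tau>)"
  define \<beta> where "\<beta> = 1 / (3 - \<tau>)"
  \<comment> \<open>The correction is paid only if \<open>F\<close> crosses \<open>U\<close> evenly:
    exactly then a cut separating \<open>s\<close> from \<open>t\<close> must be covered by the
    join.\<close>
  define w where "w U = of_bool (even (card (F \<inter> cut_edges V U))) * correction V x \<tau> U" for U
  define y where "y e = \<alpha> * of_bool (e \<in> F) + \<beta> * x e
      + (\<Sum>U\<in>N. w U * (x e * of_bool (e \<in> forward_edges V s t x \<tau> U)))" for e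
  note finE = finite_complete_edges[OF V]
  have FE: "F \<subseteq> ?E"
    using F by (simp add: spanning_tree_def)
  have "finite N"
    unfolding N_def by (rule finite_narrow_cuts[OF V])
  have x_nonneg: "0 \<le> x e" if "e \<in> ?E" for e
    using x that by (simp add: held_karp_feasible_def)
  have "\<alpha> \<ge> 0" "\<beta> > 0"
    using \<tau> by (auto simp: \<alpha>_def \<beta>_def)
  \<comment> \<open>These equations determine \<open>\<alpha>\<close> and \<open>\<beta>\<close>.
    The first serves cuts not separating \<open>s\<close> from \<open>t\<close>, with one tree edge
    and \<open>x\<close>-value 2; the second separating cuts with two tree edges and
    \<open>x\<close>-value \<open>1 + \<tau>\<close>.\<close>
  have \<alpha>\<beta>: "\<alpha> + 2 * \<beta> = 1" "2 * \<alpha> + \<beta> * (1 + \<tau>) = 1"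
  proof -
    have "\<beta> * (3 - \<tau>) = 1" "\<alpha> = (1 - \<tau>) * \<beta>"
      using \<tau> by (auto simp: \<alpha>_def \<beta>_def)
    then show "\<alpha> + 2 * \<beta> = 1" "2 * \<alpha> + \<beta> * (1 + \<tau>) = 1"
      by algebra+
  qed
  have correction_nonneg: "0 \<le> correction V x \<tau> U" if "U \<in> N" for U
  proof -
    have "1 \<le> sum x (cut_edges V U)" "sum x (cut_edges V U) < 1 + \<tau>"
      using narrow_cut_ge_1[OF x st(3,2)] that by (auto simp: N_def narrow_cuts_def)
    then show ?thesis
      using \<tau> by (simp add: correction_def)
  qed
  have w_nonneg: "0 \<le> w U" if "U \<in> N" for U
    using correction_nonneg[OF that] by (simp add: w_def)
  have sum_y: "(\<Sum>e\<in>B. f e * y e) = \<alpha> * sum f (F \<inter> B) + \<beta> * (\<Sum>e\<in>B. f e * x e)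
      + (\<Sum>U\<in>N. w U * (\<Sum>e\<in>forward_edges V s t x \<tau> U \<inter> B. f e * x e))"
    if "B \<subseteq> ?E" for B f
  proof -
    have "finite B"
      using that finE finite_subset by blast
    have restrict: "(\<Sum>e\<in>B. h e * of_bool (e \<in> A)) = sum h (A \<inter> B)" for h :: "'a set \<Rightarrow> real" and A
      unfolding Int_commute[of A] sum.inter_restrict[OF \<open>finite B\<close>] by (intro sum.cong) auto
    have "(\<Sum>e\<in>B. f e * y e) = (\<Sum>e\<in>B. \<alpha> * (f e * of_bool (e \<in> F)) + \<beta> * (f e * x e)
        + (\<Sum>U\<in>N. w U * ((f e * x e) * of_bool (e \<in> forward_edges V s t x \<tau> U))))"
      unfolding y_def distrib_left sum_distrib_left by (intro sum.cong arg_cong2[of _ _ _ _ "(+)"]) auto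
    also have "\<dots> = \<alpha> * (\<Sum>e\<in>B. f e * of_bool (e \<in> F)) + \<beta> * (\<Sum>e\<in>B. f e * x e)
        + (\<Sum>U\<in>N. w U * (\<Sum>e\<in>B. (f e * x e) * of_bool (e \<in> forward_edges V s t x \<tau> U)))"
      unfolding sum.distrib sum_distrib_left sum.swap[of _ N B] ..
    finally show ?thesis
      unfolding restrict .
  qed
  have y_nonneg: "0 \<le> y e" if "e \<in> ?E" for e
    unfolding y_def using \<open>\<alpha> \<ge> 0\<close> \<open>\<beta> > 0\<close> x_nonneg[OF that] w_nonneg
    by (intro add_nonneg_nonneg sum_nonneg mult_nonneg_nonneg) auto
  have y_cut: "1 \<le> sum y (cut_edges V S)"
    if S: "S \<subseteq> V" "odd (card (S \<inter> wrong_degree_vertices V s t F))" for S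
  proof -
    define k where "k = card (F \<inter> cut_edges V S)"
    have parity: "odd k \<noteq> (card (S \<inter> {s, t}) = 1)"
      using odd_card_wrong_degree_iff[OF V FE S(1) st] S(2) by (simp add: k_def)
    \<comment> \<open>No edge crosses \<open>V\<close>, so the number of wrong-degree vertices is
      even, and a set with an odd number of them is neither empty nor \<open>V\<close>.\<close>
    have "odd (card (F \<inter> cut_edges V {})) \<longleftrightarrow> odd (card (F \<inter> cut_edges V V))"
      using cut_edges_Diff[of V V] by simp
    moreover have "cut_edges V {} = {}"
      by (simp add: cut_edges_def)
    moreover have "V \<inter> {s, t} = {s, t}"
      using st by auto
    ultimately have "S \<noteq> {}" "S \<noteq> V"
      using S(2) odd_card_wrong_degree_iff[OF V FE _ st, of V] st(3) by auto
    then obtain a b where "a \<in> S" "b \<in> V - S"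
      using S(1) by auto
    then have "F \<inter> cut_edges V S \<noteq> {}"
      by (rule spanning_tree_meets_cut[OF F S(1)])
    moreover have "finite F"
      using FE finE finite_subset by blast
    ultimately have "k \<ge> 1"
      by (simp add: k_def Suc_le_eq card_gt_0_iff)
    have sum_y_cut: "sum y (cut_edges V S) = \<alpha> * k + \<beta> * sum x (cut_edges V S)
        + (\<Sum>U\<in>N. w U * sum x (forward_edges V s t x \<tau> U \<inter> cut_edges V S))"
      using sum_y[OF cut_edges_subset, of "\<lambda>_. 1" S] by (simp add: k_def)
    have term_nonneg: "0 \<le> w U * sum x (forward_edges V s t x \<tau> U \<inter> cut_edges V S)"
      if "U \<in> N" for U
      using w_nonneg[OF that] x_nonneg cut_edges_subset
      by (intro mult_nonneg_nonneg sum_nonneg) auto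
    have sum_term_nonneg: "0 \<le> (\<Sum>U\<in>N. w U * sum x (forward_edges V s t x \<tau> U \<inter> cut_edges V S))"
      by (rule sum_nonneg[OF term_nonneg])
    show ?thesis
    proof (cases "card (S \<inter> {s, t}) = 1")
      case False
      then have "2 \<le> sum x (cut_edges V S)"
        using x S(1) \<open>S \<noteq> {}\<close> \<open>S \<noteq> V\<close> by (simp add: held_karp_feasible_def psubset_eq)
      then have "\<beta> * 2 \<le> \<beta> * sum x (cut_edges V S)" "\<alpha> * 1 \<le> \<alpha> * k"
        using \<open>\<beta> > 0\<close> \<open>\<alpha> \<ge> 0\<close> \<open>k \<ge> 1\<close> by (intro mult_left_mono; simp)+
      then show ?thesis
        unfolding sum_y_cut using \<alpha>\<beta>(1) sum_term_nonneg by simp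
    next
      case True
      then have "k \<ge> 2" and "even k"
        using parity \<open>k \<ge> 1\<close> by (auto elim!: evenE)
      then have k: "\<alpha> * 2 \<le> \<alpha> * k"
        using \<open>\<alpha> \<ge> 0\<close> by (intro mult_left_mono) auto
      \<comment> \<open>Narrow cuts are represented by their side containing \<open>s\<close>;
        passing to the complement does not change the cut.\<close>
      define U where "U = (if s \<in> S then S else V - S)"
      have cut_U: "cut_edges V U = cut_edges V S"
        by (simp add: U_def cut_edges_Diff)
      have U: "U \<subseteq> V" "s \<in> U" "t \<notin> U"
        using True[unfolded card_Int_pair_eq_1[OF st(3)]] S(1) st by (auto simp: U_def)
      show ?thesis
      proof (cases "U \<in> N")
        case False
        then have "1 + \<tau> \<le> sum x (cut_edges V S)"
          using U cut_U by (auto simp: N_def narrow_cuts_def)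
        then have "\<beta> * (1 + \<tau>) \<le> \<beta> * sum x (cut_edges V S)"
          using \<open>\<beta> > 0\<close> by (intro mult_left_mono) auto
        then show ?thesis
          unfolding sum_y_cut using \<alpha>\<beta>(2) k sum_term_nonneg by simp
      next
        case True
        define z where "z = sum x (cut_edges V U)"
        have z: "1 \<le> z" "z < 1 + \<tau>"
          using narrow_cut_ge_1[OF x st(3,2)] True by (auto simp: z_def N_def narrow_cuts_def)
        have "forward_edges V s t x \<tau> U \<inter> cut_edges V S = forward_edges V s t x \<tau> U"
          by (auto simp: forward_edges_def cut_U)
        then have "w U * sum x (forward_edges V s t x \<tau> U \<inter> cut_edges V S)
            = correction V x \<tau> U * sum x (forward_edges V s t x \<tau> U)"
          using \<open>even k\<close> by (simp add: w_def cut_U k_def)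
        \<comment> \<open>The lower bound on the forward edges cancels the denominator of
          \<open>correction\<close>, leaving exactly the deficit
          \<open>\<beta> * (1 + \<tau> - z)\<close>.\<close>
        also have "\<dots> \<ge> correction V x \<tau> U * ((1 + z - \<tau>) / 2)"
          using sum_forward_edges_ge[OF V x st(3,2) \<tau>, of U] True correction_nonneg[OF True]
          by (intro mult_left_mono) (auto simp: z_def N_def)
        also have "correction V x \<tau> U * ((1 + z - \<tau>) / 2) = \<beta> * (1 + \<tau> - z)"
        proof -
          have "2 * a / (b * d) * (d / 2) = 1 / b * a" if "d \<noteq> 0" for a b d :: real
            using that by simp
          moreover have "1 + z - \<tau> \<noteq> 0"
            using z \<tau> by linarith
          ultimately show ?thesis
            unfolding correction_def z_def[symmetric] \<beta>_def by blast
        qed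
        finally have "\<beta> * (1 + \<tau> - z) \<le>
            (\<Sum>U\<in>N. w U * sum x (forward_edges V s t x \<tau> U \<inter> cut_edges V S))"
          using member_le_sum[OF True _ \<open>finite N\<close>,
              of "\<lambda>U. w U * sum x (forward_edges V s t x \<tau> U \<inter> cut_edges V S)"] term_nonneg
          by force
        then show ?thesis
          unfolding sum_y_cut using \<alpha>\<beta>(2) k by (simp add: z_def cut_U algebra_simps)
      qed
    qed
  qed
  have "sum c J \<le> lp_cost V c y"
    by (rule min_cost_join_le_fractional_join[OF V J nonneg y_nonneg y_cut])
  also have "\<dots> = \<alpha> * sum c F + \<beta> * lp_cost V c x
      + (\<Sum>U\<in>N. w U * (\<Sum>e\<in>forward_edges V s t x \<tau> U. c e * x e))"
    unfolding lp_cost_def using sum_y[OF subset_refl, of c] FE forward_edges_subset[of V s t x \<tau>]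
    by (simp add: Int_absorb2)
  finally show ?thesis
    by (simp add: \<alpha>_def \<beta>_def w_def N_def mult.assoc)
qed

section \<open>Averaging over the random tree\<close>

lemma sum_convex_combination:
  fixes f x :: "'b \<Rightarrow> real"
  assumes "finite B" and x: "\<And>e. e \<in> B \<Longrightarrow> x e = (\<Sum>i\<in>I. l i * indicator (A i) e)"
  shows "(\<Sum>i\<in>I. l i * sum f (A i \<inter> B)) = (\<Sum>e\<in>B. f e * x e)"
proof -
  have "(\<Sum>i\<in>I. l i * sum f (A i \<inter> B)) = (\<Sum>i\<in>I. \<Sum>e\<in>B. f e * (l i * indicator (A i) e))"
    unfolding Int_commute[of _ B] sum.inter_restrict[OF assms(1)] sum_distrib_left
    by (intro sum.cong) (auto simp: indicator_def)
  also have "\<dots> = (\<Sum>e\<in>B. f e * (\<Sum>i\<in>I. l i * indicator (A i) e))"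
    unfolding sum_distrib_left by (rule sum.swap)
  also have "\<dots> = (\<Sum>e\<in>B. f e * x e)"
    using x by (intro sum.cong) auto
  finally show ?thesis .
qed

text \<open>A cut of value \<open>z\<close> needs its correction with probability at most
  \<open>z - 1\<close>, and \<open>z - 1\<close> times the correction is at most
  \<open>\<gamma>\<close>. As forward edges of different cuts are disjoint, all corrections together
  cost at most \<open>\<gamma> * lp_cost V c x\<close> in expectation.\<close>

lemma expected_join_cost_le:
  fixes u :: real
  assumes V: "finite V" and st: "s \<in> V" "t \<in> V" "s \<noteq> t"
    and nonneg: "\<And>e. e \<in> complete_edges V \<Longrightarrow> 0 \<le> c e"
    and x: "held_karp_feasible V s t x"
    and I: "\<And>i. i \<in> I \<Longrightarrow> 0 \<le> l i" "sum l I = 1"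
    and Tr: "\<And>i. i \<in> I \<Longrightarrow> spanning_tree V (Tr i)"
    and J: "\<And>i. i \<in> I \<Longrightarrow> min_cost_join V c (wrong_degree_vertices V s t (Tr i)) (J i)"
    and conv: "\<And>e. e \<in> complete_edges V \<Longrightarrow> x e = (\<Sum>i\<in>I. l i * indicator (Tr i) e)"
    and u: "2 * u\<^sup>2 = 4 + u" "1 \<le> u" "u \<le> 2"
  shows "(\<Sum>i\<in>I. l i * sum c (J i)) \<le> (4 - 2 * u) * lp_cost V c x"
proof -
  let ?E = "complete_edges V"
  \<comment> \<open>This choice gives \<open>u\<^sup>2 = 2 * (2 - \<tau>)\<close>, which makes
    \<open>u\<close> the value of \<open>1 + z - \<tau>\<close> where the correction times
    \<open>z - 1\<close> is largest.\<close>
  define \<tau> where "\<tau> = 1 - u / 4"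
  have \<tau>: "0 \<le> \<tau>" "\<tau> \<le> 1"
    using u by (auto simp: \<tau>_def)
  define N where "N = narrow_cuts V s t x \<tau>"
  define C where "C U = (\<Sum>e\<in>forward_edges V s t x \<tau> U. c e * x e)" for U
  define \<gamma> where "\<gamma> = (u - 2)\<^sup>2 / (3 - \<tau>)"
  note finE = finite_complete_edges[OF V]
  have x_nonneg: "0 \<le> x e" if "e \<in> ?E" for e
    using x that by (simp add: held_karp_feasible_def)
  have TrE: "Tr i \<subseteq> ?E" "finite (Tr i)" if "i \<in> I" for i
    using Tr[OF that] finE finite_subset by (auto simp: spanning_tree_def)
  have C_nonneg: "0 \<le> C U" for U
    unfolding C_def
  proof (rule sum_nonneg)
    fix e assume "e \<in> forward_edges V s t x \<tau> U"
    then have "e \<in> complete_edges V"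
      by (rule subsetD[OF forward_edges_subset])
    then show "0 \<le> c e * x e"
      using nonneg x_nonneg by simp
  qed
  have "finite N"
    unfolding N_def by (rule finite_narrow_cuts[OF V])
  \<comment> \<open>Taking \<open>c\<close> on all edges gives the expected tree cost; taking the
    constant 1 on a cut gives the expected number of crossings.\<close>
  have average: "(\<Sum>i\<in>I. l i * sum f (Tr i \<inter> B)) = (\<Sum>e\<in>B. f e * x e)" if "B \<subseteq> ?E" for B f
    using that conv finite_subset[OF that finE] by (intro sum_convex_combination) auto
  have average_cost: "(\<Sum>i\<in>I. l i * sum c (Tr i)) = lp_cost V c x"
    using average[OF subset_refl, of c] TrE(1) by (simp add: lp_cost_def Int_absorb2)
  have even_prob: "(\<Sum>i\<in>I. l i * of_bool (even (card (Tr i \<inter> cut_edges V U))))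
      \<le> sum x (cut_edges V U) - 1" if "U \<in> N" for U
  proof -
    have U: "U \<subseteq> V" "s \<in> U" "t \<in> V - U"
      using that st by (auto simp: N_def narrow_cuts_def)
    \<comment> \<open>A tree crosses the cut at least once, and an even number of crossings is at
      least 2. Thus the expected number of crossings minus 1 bounds the probability of an even
      crossing.\<close>
    have "of_bool (even (card (Tr i \<inter> cut_edges V U))) \<le> real (card (Tr i \<inter> cut_edges V U)) - 1"
      if "i \<in> I" for i
    proof -
      have "card (Tr i \<inter> cut_edges V U) \<noteq> 0"
        using spanning_tree_meets_cut[OF Tr[OF that] U] TrE(2)[OF that] by simp
      then show ?thesis
        by (cases "card (Tr i \<inter> cut_edges V U) = 1") auto
    qed
    then have "(\<Sum>i\<in>I. l i * of_bool (even (card (Tr i \<inter> cut_edges V U))))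
        \<le> (\<Sum>i\<in>I. l i * (real (card (Tr i \<inter> cut_edges V U)) - 1))"
      using I(1) by (intro sum_mono mult_left_mono) auto
    also have "\<dots> = sum x (cut_edges V U) - 1"
      using average[OF cut_edges_subset, of "\<lambda>_. 1" U] I(2)
      by (simp add: right_diff_distrib sum_subtractf)
    finally show ?thesis .
  qed
  have correction_le: "correction V x \<tau> U * (sum x (cut_edges V U) - 1) \<le> \<gamma>"
    and correction_nonneg: "0 \<le> correction V x \<tau> U" if "U \<in> N" for U
  proof -
    define z where "z = sum x (cut_edges V U)"
    have z: "1 \<le> z" "z < 1 + \<tau>"
      using narrow_cut_ge_1[OF x st(3,2)] that by (auto simp: z_def N_def narrow_cuts_def)
    then show "0 \<le> correction V x \<tau> U"
      using \<tau> by (simp add: correction_def z_def[symmetric])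
    \<comment> \<open>The square vanishes at the maximiser \<open>1 + z - \<tau> = u\<close>;
      expanding it with the equation for \<open>u\<close> yields the bound.\<close>
    have "0 \<le> 2 * (1 + z - \<tau> - u)\<^sup>2"
      by simp
    also have "\<dots> = (u - 2)\<^sup>2 * (1 + z - \<tau>) - 2 * (1 + \<tau> - z) * (z - 1)"
      using u(1) unfolding \<tau>_def by algebra
    finally have *: "2 * (1 + \<tau> - z) * (z - 1) \<le> (u - 2)\<^sup>2 * (1 + z - \<tau>)"
      by simp
    have "0 < 1 + z - \<tau>" "0 < 3 - \<tau>"
      using z \<tau> by auto
    then show "correction V x \<tau> U * (sum x (cut_edges V U) - 1) \<le> \<gamma>"
      using * unfolding correction_def z_def[symmetric] \<gamma>_def
      by (simp add: divide_simps mult_ac)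
  qed
  have "(\<Sum>i\<in>I. \<Sum>U\<in>N. l i * of_bool (even (card (Tr i \<inter> cut_edges V U))) * (correction V x \<tau> U * C U))
      = (\<Sum>U\<in>N. (\<Sum>i\<in>I. l i * of_bool (even (card (Tr i \<inter> cut_edges V U)))) * (correction V x \<tau> U * C U))"
    unfolding sum_distrib_right by (rule sum.swap)
  also have "\<dots> \<le> (\<Sum>U\<in>N. (sum x (cut_edges V U) - 1) * (correction V x \<tau> U * C U))"
    using even_prob correction_nonneg C_nonneg by (intro sum_mono mult_right_mono) auto
  also have "\<dots> \<le> (\<Sum>U\<in>N. \<gamma> * C U)"
  proof (rule sum_mono)
    fix U assume "U \<in> N"
    then show "(sum x (cut_edges V U) - 1) * (correction V x \<tau> U * C U) \<le> \<gamma> * C U"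
      using mult_right_mono[OF correction_le C_nonneg, of U U] by (simp only: mult_ac)
  qed
  also have "\<dots> = \<gamma> * (\<Sum>e\<in>(\<Union>U\<in>N. forward_edges V s t x \<tau> U). c e * x e)"
  proof -
    have "(\<Sum>e\<in>(\<Union>U\<in>N. forward_edges V s t x \<tau> U). c e * x e) = (\<Sum>U\<in>N. C U)"
      unfolding C_def
    proof (rule sum.UNION_disjoint[OF \<open>finite N\<close>])
      show "\<forall>U\<in>N. finite (forward_edges V s t x \<tau> U)"
        by (intro ballI finite_subset[OF forward_edges_subset finE])
      show "\<forall>A\<in>N. \<forall>B\<in>N. A \<noteq> B \<longrightarrow> forward_edges V s t x \<tau> A \<inter> forward_edges V s t x \<tau> B = {}"
        using forward_edges_disjoint[OF V x st(3,2) \<tau>(2)] by (auto simp: N_def)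
    qed
    then show ?thesis
      by (simp add: sum_distrib_left)
  qed
  also have "\<dots> \<le> \<gamma> * lp_cost V c x"
    unfolding lp_cost_def
  proof (intro mult_left_mono sum_mono2 finE)
    show "(\<Union>U\<in>N. forward_edges V s t x \<tau> U) \<subseteq> ?E"
      by (intro UN_least forward_edges_subset)
    show "0 \<le> \<gamma>"
      using \<tau> by (simp add: \<gamma>_def)
  qed (use nonneg x_nonneg in auto)
  finally have corrections: "(\<Sum>i\<in>I. \<Sum>U\<in>N. l i * of_bool (even (card (Tr i \<inter> cut_edges V U)))
      * (correction V x \<tau> U * C U)) \<le> \<gamma> * lp_cost V c x" .
  have "(\<Sum>i\<in>I. l i * sum c (J i)) \<le> (\<Sum>i\<in>I. l i * ((1 - \<tau>) / (3 - \<tau>) * sum c (Tr i)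
      + 1 / (3 - \<tau>) * lp_cost V c x
      + (\<Sum>U\<in>N. of_bool (even (card (Tr i \<inter> cut_edges V U))) * (correction V x \<tau> U * C U))))"
    unfolding N_def C_def
    using I(1) min_cost_join_le_correction[OF V st nonneg x Tr J \<tau>]
    by (intro sum_mono mult_left_mono)
  also have "\<dots> = (1 - \<tau>) / (3 - \<tau>) * (\<Sum>i\<in>I. l i * sum c (Tr i))
      + sum l I * (1 / (3 - \<tau>) * lp_cost V c x)
      + (\<Sum>i\<in>I. \<Sum>U\<in>N. l i * of_bool (even (card (Tr i \<inter> cut_edges V U))) * (correction V x \<tau> U * C U))"
    unfolding distrib_left sum.distrib sum_distrib_left sum_distrib_right
    by (intro arg_cong2[of _ _ _ _ "(+)"] sum.cong refl) (simp_all only: mult_ac)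
  also have "\<dots> \<le> (1 - \<tau>) / (3 - \<tau>) * (\<Sum>i\<in>I. l i * sum c (Tr i))
      + sum l I * (1 / (3 - \<tau>) * lp_cost V c x) + \<gamma> * lp_cost V c x"
    by (rule add_left_mono[OF corrections])
  also have "\<dots> = (4 - 2 * u) * lp_cost V c x"
  proof -
    have "(1 - \<tau>) / (3 - \<tau>) + 1 / (3 - \<tau>) + \<gamma> = (1 - \<tau> + 1 + (u - 2)\<^sup>2) / (3 - \<tau>)"
      unfolding \<gamma>_def add_divide_distrib ..
    also have "1 - \<tau> + 1 + (u - 2)\<^sup>2 = (4 - 2 * u) * (3 - \<tau>)"
      using u(1) unfolding \<tau>_def by algebra
    finally have "(1 - \<tau>) / (3 - \<tau>) + 1 / (3 - \<tau>) + \<gamma> = 4 - 2 * u"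
      using \<tau> by simp
    then show ?thesis
      unfolding average_cost I(2) mult_1 distrib_right[symmetric] by simp
  qed
  finally show ?thesis .
qed

theorem theorem13:
  fixes V :: "'a set" and c x :: "'a set \<Rightarrow> real" and s t :: 'a
    and k :: nat and l :: "nat \<Rightarrow> real" and p :: "nat pmf"
    and Tr J :: "nat \<Rightarrow> 'a set set" and W H :: "nat \<Rightarrow> 'a list"
  assumes "finite V" and "s \<in> V" and "t \<in> V" and "s \<noteq> t"
    and "metric_cost V c"
    and "held_karp_optimal V c s t x"
    and "\<And>i. i \<in> {1..k} \<Longrightarrow> spanning_tree V (Tr i)"
    and "\<And>i. i \<in> {1..k} \<Longrightarrow> 0 \<le> l i" and "(\<Sum>i = 1..k. l i) = 1"
    and "\<And>e. e \<in> complete_edges V \<Longrightarrow> x e = (\<Sum>i = 1..k. l i * indicator (Tr i) e)"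
    and "\<And>i. i \<in> {1..k} \<Longrightarrow> pmf p i = l i"
    and "\<And>i. i \<in> {1..k} \<Longrightarrow> min_cost_join V c (wrong_degree_vertices V s t (Tr i)) (J i)"
    and "\<And>i. i \<in> {1..k} \<Longrightarrow> eulerian_path (mset_set (Tr i) + mset_set (J i)) s t (W i)"
    and "\<And>i. i \<in> {1..k} \<Longrightarrow> hamiltonian_shortcut V s t (W i) (H i)"
  shows "measure_pmf.expectation p (\<lambda>i. sum c (set (path_edges (H i))))
           \<le> (9 - sqrt 33) / 2 * lp_cost V c x"
proof -
  let ?I = "{1..k}"
  \<comment> \<open>The positive root of \<open>2 * u\<^sup>2 = 4 + u\<close>, for which
    \<open>1 + (4 - 2 * u)\<close> is the claimed ratio.\<close>
  define u where "u = (1 + sqrt 33) / 4"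
  have "sqrt 33 = 4 * u - 1"
    by (simp add: u_def field_simps)
  then have "(4 * u - 1)\<^sup>2 = 33"
    by (metis real_sqrt_pow2 zero_le_numeral)
  then have u: "2 * u\<^sup>2 = 4 + u"
    by (simp add: power2_eq_square algebra_simps)
  have "3 \<le> sqrt 33" "sqrt 33 \<le> 7"
    by (simp_all add: real_le_rsqrt real_le_lsqrt)
  then have u_bounds: "1 \<le> u" "u \<le> 2"
    by (simp_all add: u_def)
  have feasible: "held_karp_feasible V s t x"
    using assms(6) by (simp add: held_karp_optimal_def)
  have nonneg: "0 \<le> c e" if "e \<in> complete_edges V" for e
    using assms(5) that by (simp add: metric_cost_def)
  \<comment> \<open>The weights on \<open>{1..k}\<close> already sum to 1, so \<open>p\<close> has
    no mass elsewhere and the expectation is a finite sum.\<close>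
  have "measure_pmf.prob p ?I = 1"
    using assms(9,11) by (simp add: measure_measure_pmf_finite)
  then have "set_pmf p \<subseteq> ?I"
    by (simp add: measure_pmf.prob_eq_1 AE_measure_pmf_iff subset_iff)
  then have "measure_pmf.expectation p (\<lambda>i. sum c (set (path_edges (H i))))
      = (\<Sum>i\<in>?I. sum c (set (path_edges (H i))) * pmf p i)"
    by (intro integral_measure_pmf_real) auto
  also have "\<dots> \<le> (\<Sum>i\<in>?I. l i * (sum c (Tr i) + sum c (J i)))"
  proof (rule sum_mono)
    fix i assume i: "i \<in> ?I"
    have "Tr i \<subseteq> complete_edges V" "J i \<subseteq> complete_edges V"
      using assms(7,12)[OF i] by (auto simp: spanning_tree_def min_cost_join_def is_join_def)
    then have "sum c (set (path_edges (H i))) \<le> sum c (Tr i) + sum c (J i)"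
      using shortcut_cost_le assms(1,2,5,13,14) i by metis
    then show "sum c (set (path_edges (H i))) * pmf p i \<le> l i * (sum c (Tr i) + sum c (J i))"
      using assms(8,11)[OF i] by (simp add: mult.commute mult_left_mono)
  qed
  also have "\<dots> = (\<Sum>i\<in>?I. l i * sum c (Tr i)) + (\<Sum>i\<in>?I. l i * sum c (J i))"
    by (simp add: distrib_left sum.distrib)
  also have "(\<Sum>i\<in>?I. l i * sum c (Tr i)) = lp_cost V c x"
  proof -
    have "Tr i \<inter> complete_edges V = Tr i" if "i \<in> ?I" for i
      using assms(7)[OF that] by (auto simp: spanning_tree_def)
    then show ?thesis
      using sum_convex_combination[OF finite_complete_edges[OF assms(1)] assms(10), of c]
      by (simp add: lp_cost_def)
  qed
  also have "lp_cost V c x + (\<Sum>i\<in>?I. l i * sum c (J i)) \<le> lp_cost V c x + (4 - 2 * u) * lp_cost V c x"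
    by (rule add_left_mono, rule expected_join_cost_le[OF assms(1-4) nonneg feasible assms(8,9,7,12,10) u u_bounds])
  also have "\<dots> = (9 - sqrt 33) / 2 * lp_cost V c x"
    by (simp add: u_def field_simps)
  finally show ?thesis .
qed

end
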